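(* For any $\varepsilon>0$, $\lambda_b<\lambda_0$.
   Context: Consider $\varepsilon^2u''=u^3-\lambda u+\cos t$. Let $\lambda_0=3/2^{2/3}$. For every $\lambda\in\mathbb{R}$ and $\varepsilon>0$, $u_p$ denotes the unique $2\pi$-periodic solution with $u'(0)=0$, $u(\pi/2)=0$ and $u'>0$ on $(0,\pi/2)$ (it also satisfies $u_p'(\pi)=0$). For given $\varepsilon>0$, $$\lambda_b=\sup\{\lambda:\ \text{there is only one solution, } u_p, \text{ with } u'(0)=0,\ u'(\pi)=0\}.$$ *)

theory Defs
  imports Complex_Main "HOL-Library.Extended_Real"
begin

definition lambda0 :: real where
  "lambda0 = 3 / 2 powr (2 / 3)"

text \<open>\<open>u'\<close> is the derivative of \<open>u\<close> on \<open>S\<close>; at an endpoint of a closed interval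
  the derivatives are one-sided.\<close>

definition solution_on :: "real set \<Rightarrow> real \<Rightarrow> real \<Rightarrow> (real \<Rightarrow> real) \<Rightarrow> (real \<Rightarrow> real) \<Rightarrow> bool" where
  "solution_on S \<epsilon> lam u u' \<longleftrightarrow>
     (\<forall>t\<in>S. (u has_real_derivative u' t) (at t within S) \<and>
        (\<exists>a. (u' has_real_derivative a) (at t within S) \<and>
             \<epsilon>\<^sup>2 * a = u t ^ 3 - lam * u t + cos t))"

definition bvp_solution :: "real \<Rightarrow> real \<Rightarrow> (real \<Rightarrow> real) \<Rightarrow> bool" where
  "bvp_solution \<epsilon> lam u \<longleftrightarrow> (\<exists>u'. solution_on {0..pi} \<epsilon> lam u u' \<and> u' 0 = 0 \<and> u' pi = 0)"

definition is_u_p :: "real \<Rightarrow> real \<Rightarrow> (real \<Rightarrow> real) \<Rightarrow> bool" where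
  "is_u_p \<epsilon> lam u \<longleftrightarrow>
     (\<exists>u'. solution_on UNIV \<epsilon> lam u u' \<and> (\<forall>t. u (t + 2 * pi) = u t) \<and>
        u' 0 = 0 \<and> u (pi / 2) = 0 \<and> (\<forall>t\<in>{0<..<pi / 2}. u' t > 0))"

text \<open>Solutions of the boundary value problem live on \<open>[0, \<pi>]\<close>, so they are compared there only.\<close>

definition only_u_p :: "real \<Rightarrow> real \<Rightarrow> bool" where
  "only_u_p \<epsilon> lam \<longleftrightarrow>
     (\<exists>u. is_u_p \<epsilon> lam u \<and> bvp_solution \<epsilon> lam u \<and>
        (\<forall>v. bvp_solution \<epsilon> lam v \<longrightarrow> (\<forall>t\<in>{0..pi}. v t = u t)))"

text \<open>The supremum is taken in the extended reals, since on \<^typ>\<open>real\<close> the value of \<^const>\<open>Sup\<close>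
  is unspecified for sets that are not bounded above.\<close>

definition lambda_b :: "real \<Rightarrow> ereal" where
  "lambda_b \<epsilon> = Sup (ereal ` {lam. only_u_p \<epsilon> lam})"

end

theory Submission
  imports Defs "HOL-Analysis.Analysis"
begin

text \<open>
  Put \<open>m = 2 powr (- 1/3)\<close>, so that \<open>2 * m^3 = 1\<close> and \<open>lambda0 = 3 * m^2\<close>. At \<open>lam = lambda0\<close> the
  constant \<open>m\<close> is a lower solution which fails to be strict only where \<open>cos t = 1\<close>. Bending it
  to \<open>m - \<eta> * cos t\<close> with a small \<open>\<eta> > 0\<close> gains \<open>\<epsilon>^2 * \<eta>\<close> there and costs only \<open>O(\<eta>^2)\<close>, so it
  is a positive lower solution for all \<open>lam \<ge> lambda0 - \<delta>\<close>, with some \<open>\<delta> > 0\<close> depending on \<open>\<epsilon>\<close>.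
  A large constant is an upper solution. The solution between the two is positive, whereas
  \<open>u_p\<close> vanishes at \<open>pi / 2\<close>.

  The solution between a lower and an upper solution is a fixed point of the solution operator
  of \<open>w'' - k^2 * w = f t v - k^2 * v\<close>. This operator is monotone by the maximum principle and
  takes values in the functions with a fixed Lipschitz constant. As these are closed under
  pointwise suprema, the argument of Knaster and Tarski applies.
\<close>

section \<open>The linear Neumann problem: maximum principle and solvability\<close>

text \<open>At a negative minimum the slope vanishes, by Fermat's theorem inside and by
  \<open>bc\<close> at an endpoint. As \<open>z''\<close> is negative there, \<open>z\<close> drops
  strictly when moving away into the interval, against minimality.\<close>

lemma neumann_maximum_principle:
  fixes z z' z'' :: "real \<Rightarrow> real"
  assumes "a < b"
    and z: "\<And>t. t \<in> {a..b} \<Longrightarrow> (z has_real_derivative z' t) (at t within {a..b})"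
    and z': "\<And>t. t \<in> {a..b} \<Longrightarrow> (z' has_real_derivative z'' t) (at t within {a..b})"
    and bc: "z' a = 0" "z' b = 0"
    and neg: "\<And>t. t \<in> {a..b} \<Longrightarrow> z t < 0 \<Longrightarrow> z'' t < 0"
    and t: "t \<in> {a..b}"
  shows "0 \<le> z t"
proof (rule ccontr)
  assume "\<not> 0 \<le> z t"
  have "continuous_on {a..b} z"
    using z by (rule DERIV_continuous_on)
  then obtain c where c: "c \<in> {a..b}" and min: "\<And>s. s \<in> {a..b} \<Longrightarrow> z c \<le> z s"
    using continuous_attains_inf[of "{a..b}" z] \<open>a < b\<close> by auto
  have "z c < 0"
    using min[OF t] \<open>\<not> 0 \<le> z t\<close> by linarith
  then have "z'' c < 0"
    using neg c by blast
  have "z' c = 0"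
  proof (cases "a < c \<and> c < b")
    case True
    then have "(z has_real_derivative z' c) (at c)"
      using z[OF c] by (simp add: at_within_Icc_at)
    moreover have "\<forall>s. \<bar>c - s\<bar> < min (c - a) (b - c) \<longrightarrow> z c \<le> z s"
      by (intro allI impI min) (auto simp: abs_less_iff)
    ultimately show ?thesis
      using True DERIV_local_min[of z "z' c" c "min (c - a) (b - c)"] by simp
  next
    case False
    then have "c = a \<or> c = b" using c by auto
    then show ?thesis using bc by auto
  qed
  have mvt: "\<exists>x\<in>{p<..<q}. z q - z p = z' x * (q - p)" if pq: "a \<le> p" "p < q" "q \<le> b" for p q
    using \<open>p < q\<close>
  proof (rule mvt_simple)
    fix x assume "p \<le> x" "x \<le> q"
    then have "(z has_real_derivative z' x) (at x within {p..q})"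
      using pq by (intro DERIV_subset[OF z]) auto
    then show "(z has_derivative (*) (z' x)) (at x within {p..q})"
      by (simp add: has_field_derivative_def)
  qed
  \<comment> \<open>A minimum at \<open>b\<close> leaves room only on its left, every other one has
    room on its right.\<close>
  show False
  proof (cases "c < b")
    case True
    obtain d where d: "d > 0" and dec: "\<And>h. h > 0 \<Longrightarrow> c + h \<in> {a..b} \<Longrightarrow> h < d \<Longrightarrow> z' (c + h) < z' c"
      using has_real_derivative_neg_dec_right[OF z'[OF c] \<open>z'' c < 0\<close>] by blast
    define s where "s = c + min (d / 2) (b - c)"
    have s: "c < s" "s \<le> b" "s - c < d"
      using d True by (auto simp: s_def min_def)
    then obtain x where x: "c < x" "x < s" "z s - z c = z' x * (s - c)"
      using mvt[of c s] c by auto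
    have "z' x < 0"
      using dec[of "x - c"] x s c \<open>z' c = 0\<close> by auto
    then have "z s < z c"
      using x s mult_neg_pos[of "z' x" "s - c"] by linarith
    then show False
      using min[of s] s c by auto
  next
    case False
    then have "a < c" using c \<open>a < b\<close> by auto
    obtain d where d: "d > 0" and dec: "\<And>h. h > 0 \<Longrightarrow> c - h \<in> {a..b} \<Longrightarrow> h < d \<Longrightarrow> z' c < z' (c - h)"
      using has_real_derivative_neg_dec_left[OF z'[OF c] \<open>z'' c < 0\<close>] by blast
    define s where "s = c - min (d / 2) (c - a)"
    have s: "s < c" "a \<le> s" "c - s < d"
      using d \<open>a < c\<close> by (auto simp: s_def min_def)
    then obtain x where x: "s < x" "x < c" "z c - z s = z' x * (c - s)"
      using mvt[of s c] c by auto
    have "0 < z' x"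
      using dec[of "c - x"] x s c \<open>z' c = 0\<close> by auto
    then have "z s < z c"
      using x s mult_pos_pos[of "z' x" "c - s"] by linarith
    then show False
      using min[of s] s c by auto
  qed
qed

text \<open>Variation of constants for \<open>w'' = k^2 * w - h\<close>: a particular solution with
  zero data at \<open>a\<close>, corrected by a multiple of \<open>cosh (k * (t - a))\<close>, which
  keeps the slope at \<open>a\<close> equal to zero.\<close>

lemma neumann_linear_solution:
  fixes h :: "real \<Rightarrow> real"
  assumes "a < b" "k > 0" and h: "continuous_on {a..b} h"
  obtains w w' where
    "\<And>t. t \<in> {a..b} \<Longrightarrow> (w has_real_derivative w' t) (at t within {a..b})"
    "\<And>t. t \<in> {a..b} \<Longrightarrow> (w' has_real_derivative k\<^sup>2 * w t - h t) (at t within {a..b})"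
    "w' a = 0" "w' b = 0"
proof -
  \<comment> \<open>\<open>E c\<close> solves \<open>y' = c * y + h\<close> with
    \<open>y a = 0\<close>. The exponents \<open>k\<close> and \<open>- k\<close> factor the
    second-order operator, and \<open>(P - Q) / (2 * k)\<close> solves
    \<open>y'' = k^2 * y + h\<close> with \<open>y a = y' a = 0\<close>.\<close>
  define E where "E c t = exp (c * t) * integral {a..t} (\<lambda>s. exp (- (c * s)) * h s)" for c t
  define P where "P = E k"
  define Q where "Q = E (- k)"
  have E: "(E c has_real_derivative c * E c t + h t) (at t within {a..b})" if t: "t \<in> {a..b}" for c t
  proof -
    have "((\<lambda>t. integral {a..t} (\<lambda>s. exp (- (c * s)) * h s)) has_real_derivative exp (- (c * t)) * h t)
        (at t within {a..b})"
      by (intro integral_has_real_derivative continuous_intros h t)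
    moreover have "((\<lambda>t. exp (c * t)) has_real_derivative c * exp (c * t)) (at t within {a..b})"
      by (auto intro!: derivative_eq_intros)
    ultimately have "(E c has_real_derivative
        c * exp (c * t) * integral {a..t} (\<lambda>s. exp (- (c * s)) * h s)
        + exp (- (c * t)) * h t * exp (c * t)) (at t within {a..b})"
      unfolding E_def by (intro DERIV_mult)
    moreover have "exp (- (c * t)) * h t * exp (c * t) = h t"
      by (simp add: exp_minus)
    ultimately show ?thesis
      by (simp only: E_def mult.assoc)
  qed
  have P: "(P has_real_derivative k * P t + h t) (at t within {a..b})" if "t \<in> {a..b}" for t
    using E[OF that, of k] by (simp add: P_def)
  have Q: "(Q has_real_derivative h t - k * Q t) (at t within {a..b})" if "t \<in> {a..b}" for t
    using E[OF that, of "- k"] by (simp add: Q_def)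
  \<comment> \<open>This value is forced by \<open>w' b = 0\<close>.\<close>
  define A where "A = (P b + Q b) / (2 * k * sinh (k * (b - a)))"
  define c where "c = 1 / (2 * k)"
  have ck: "c * k = 1 / 2" using \<open>k > 0\<close> by (simp add: c_def)
  define w where "w t = A * cosh (k * (t - a)) - c * (P t - Q t)" for t
  define w' where "w' t = A * k * sinh (k * (t - a)) - (P t + Q t) / 2" for t
  show ?thesis
  proof (rule that[of w w'])
    fix t assume t: "t \<in> {a..b}"
    have "(w has_real_derivative A * (sinh (k * (t - a)) * k) - c * ((k * P t + h t) - (h t - k * Q t)))
        (at t within {a..b})"
      unfolding w_def by (auto intro!: derivative_eq_intros P Q t)
    also have "A * (sinh (k * (t - a)) * k) - c * ((k * P t + h t) - (h t - k * Q t))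
        = A * k * sinh (k * (t - a)) - c * k * (P t + Q t)"
      by (simp add: algebra_simps)
    also have "\<dots> = w' t"
      by (simp add: w'_def ck)
    finally show "(w has_real_derivative w' t) (at t within {a..b})" .
    have "(w' has_real_derivative A * k * (cosh (k * (t - a)) * k) - ((k * P t + h t) + (h t - k * Q t)) / 2)
        (at t within {a..b})"
      unfolding w'_def by (auto intro!: derivative_eq_intros P Q t)
    also have "A * k * (cosh (k * (t - a)) * k) - ((k * P t + h t) + (h t - k * Q t)) / 2
        = k\<^sup>2 * (A * cosh (k * (t - a))) - k * (1 / 2) * (P t - Q t) - h t"
      by (simp add: power2_eq_square add_divide_distrib diff_divide_distrib right_diff_distrib)
    also have "\<dots> = k\<^sup>2 * w t - h t"
      unfolding ck[symmetric] w_def by (simp add: power2_eq_square right_diff_distrib)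
    finally show "(w' has_real_derivative k\<^sup>2 * w t - h t) (at t within {a..b})" .
  next
    show "w' a = 0" by (simp add: w'_def P_def Q_def E_def)
    have "sinh (k * (b - a)) \<noteq> 0" using assms by simp
    then show "w' b = 0" using \<open>k > 0\<close> by (simp add: w'_def A_def)
  qed
qed

section \<open>The method of lower and upper solutions\<close>

text \<open>Subtracting \<open>k^2 * u\<close> on both sides of \<open>u'' = f t u\<close> makes the
  left side invertible with a sign. By \<open>mono\<close> the source \<open>k^2 * v - f t v\<close>
  grows with \<open>v\<close>, so the solution operator preserves order between \<alpha> and
  \<beta>.\<close>

lemma neumann_between_lower_and_upper_solution:
  fixes f :: "real \<Rightarrow> real \<Rightarrow> real" and \<alpha> \<alpha>' \<alpha>'' \<beta> \<beta>' \<beta>'' :: "real \<Rightarrow> real"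
  assumes "a < b" "k > 0"
    and f: "continuous_on ({a..b} \<times> UNIV) (\<lambda>(t, x). f t x)"
    and mono: "\<And>t x y. t \<in> {a..b} \<Longrightarrow> \<alpha> t \<le> x \<Longrightarrow> x \<le> y \<Longrightarrow> y \<le> \<beta> t \<Longrightarrow>
                 k\<^sup>2 * x - f t x \<le> k\<^sup>2 * y - f t y"
    and le: "\<And>t. t \<in> {a..b} \<Longrightarrow> \<alpha> t \<le> \<beta> t"
    and \<alpha>: "\<And>t. t \<in> {a..b} \<Longrightarrow> (\<alpha> has_real_derivative \<alpha>' t) (at t within {a..b})"
    and \<alpha>': "\<And>t. t \<in> {a..b} \<Longrightarrow> (\<alpha>' has_real_derivative \<alpha>'' t) (at t within {a..b})"
    and \<alpha>bc: "\<alpha>' a = 0" "\<alpha>' b = 0"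
    and lower: "\<And>t. t \<in> {a..b} \<Longrightarrow> f t (\<alpha> t) \<le> \<alpha>'' t"
    and \<beta>: "\<And>t. t \<in> {a..b} \<Longrightarrow> (\<beta> has_real_derivative \<beta>' t) (at t within {a..b})"
    and \<beta>': "\<And>t. t \<in> {a..b} \<Longrightarrow> (\<beta>' has_real_derivative \<beta>'' t) (at t within {a..b})"
    and \<beta>bc: "\<beta>' a = 0" "\<beta>' b = 0"
    and upper: "\<And>t. t \<in> {a..b} \<Longrightarrow> \<beta>'' t \<le> f t (\<beta> t)"
  obtains u u' where
    "\<And>t. t \<in> {a..b} \<Longrightarrow> (u has_real_derivative u' t) (at t within {a..b})"
    "\<And>t. t \<in> {a..b} \<Longrightarrow> (u' has_real_derivative f t (u t)) (at t within {a..b})"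
    "u' a = 0" "u' b = 0"
    "\<And>t. t \<in> {a..b} \<Longrightarrow> \<alpha> t \<le> u t \<and> u t \<le> \<beta> t"
proof -
  define sol where "sol v w w' \<longleftrightarrow>
      (\<forall>t\<in>{a..b}. (w has_real_derivative w' t) (at t within {a..b}) \<and>
         (w' has_real_derivative k\<^sup>2 * w t - (k\<^sup>2 * v t - f t (v t))) (at t within {a..b})) \<and>
      w' a = 0 \<and> w' b = 0" for v w w'
  define ordint where "ordint v \<longleftrightarrow> continuous_on {a..b} v \<and> (\<forall>t\<in>{a..b}. \<alpha> t \<le> v t \<and> v t \<le> \<beta> t)" for v
  have cf: "continuous_on {a..b} (\<lambda>t. f t (v t))" if "continuous_on {a..b} v" for v
  proof -
    have "continuous_on {a..b} (\<lambda>t. (t, v t))"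
      by (intro continuous_intros that)
    then show ?thesis
      using continuous_on_compose2[OF f, of "{a..b}" "\<lambda>t. (t, v t)"] by auto
  qed
  \<comment> \<open>Continuity sits under the quantifiers so that choice yields an operator
    \<open>T\<close> defined on all functions.\<close>
  have "\<exists>w w'. continuous_on {a..b} v \<longrightarrow> sol v w w'" for v
  proof (cases "continuous_on {a..b} v")
    case True
    then have h: "continuous_on {a..b} (\<lambda>t. k\<^sup>2 * v t - f t (v t))"
      by (intro continuous_on_diff continuous_on_mult continuous_on_const cf)
    show ?thesis
    proof (rule neumann_linear_solution[OF \<open>a < b\<close> \<open>k > 0\<close> h])
      fix w w'
      assume "\<And>t. t \<in> {a..b} \<Longrightarrow> (w has_real_derivative w' t) (at t within {a..b})"
        "\<And>t. t \<in> {a..b} \<Longrightarrow>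
          (w' has_real_derivative k\<^sup>2 * w t - (k\<^sup>2 * v t - f t (v t))) (at t within {a..b})"
        "w' a = 0" "w' b = 0"
      then have "sol v w w'"
        unfolding sol_def by blast
      then show ?thesis by blast
    qed
  qed blast
  then obtain T T' where T: "\<And>v. continuous_on {a..b} v \<Longrightarrow> sol v (T v) (T' v)"
    by metis
  have DT: "(T v has_real_derivative T' v t) (at t within {a..b})"
       "(T' v has_real_derivative k\<^sup>2 * T v t - (k\<^sup>2 * v t - f t (v t))) (at t within {a..b})"
       "T' v a = 0" "T' v b = 0"
    if "continuous_on {a..b} v" "t \<in> {a..b}" for v t
    using T[OF that(1)] that(2) unfolding sol_def by auto
  have ab: "a \<in> {a..b}" using \<open>a < b\<close> by simp
  have T_mono: "T v t \<le> T w t"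
    if "ordint v" "ordint w" "\<And>s. s \<in> {a..b} \<Longrightarrow> v s \<le> w s" "t \<in> {a..b}" for v w t
  proof -
    have v: "continuous_on {a..b} v" and w: "continuous_on {a..b} w"
      using that by (auto simp: ordint_def)
    have "0 \<le> T w t - T v t"
    \<comment> \<open>The difference \<open>z\<close> satisfies \<open>z'' = k^2 * z - g\<close>,
      where \<open>g\<close> is the increase of the source from \<open>v\<close> to
      \<open>w\<close>. Since \<open>g\<close> is nonnegative, \<open>z'' < 0\<close> wherever
      \<open>z < 0\<close>.\<close>
    proof (rule neumann_maximum_principle[OF \<open>a < b\<close>, where z = "\<lambda>t. T w t - T v t"])
      fix s assume s: "s \<in> {a..b}"
      show "((\<lambda>t. T w t - T v t) has_real_derivative T' w s - T' v s) (at s within {a..b})"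
        by (intro DERIV_diff DT v w s)
      show "((\<lambda>t. T' w t - T' v t) has_real_derivative
         (k\<^sup>2 * T w s - (k\<^sup>2 * w s - f s (w s))) - (k\<^sup>2 * T v s - (k\<^sup>2 * v s - f s (v s)))) (at s within {a..b})"
        by (intro DERIV_diff DT v w s)
      assume "T w s - T v s < 0"
      then have "k\<^sup>2 * (T w s - T v s) < 0"
        using \<open>k > 0\<close> by (simp add: mult_pos_neg)
      moreover have "k\<^sup>2 * v s - f s (v s) \<le> k\<^sup>2 * w s - f s (w s)"
        using mono[of s "v s" "w s"] that s by (auto simp: ordint_def)
      ultimately show "(k\<^sup>2 * T w s - (k\<^sup>2 * w s - f s (w s))) - (k\<^sup>2 * T v s - (k\<^sup>2 * v s - f s (v s))) < 0"
        by (simp add: algebra_simps)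
    qed (use DT[OF v ab] DT[OF w ab] that in auto)
    then show ?thesis by simp
  qed
  have c\<alpha>: "continuous_on {a..b} \<alpha>" and c\<beta>: "continuous_on {a..b} \<beta>"
    using DERIV_continuous_on[OF \<alpha>] DERIV_continuous_on[OF \<beta>] by simp_all
  have o\<alpha>: "ordint \<alpha>" and o\<beta>: "ordint \<beta>"
    using c\<alpha> c\<beta> le by (auto simp: ordint_def)
  have T_lower: "\<alpha> t \<le> T \<alpha> t" if "t \<in> {a..b}" for t
  proof -
    have "0 \<le> T \<alpha> t - \<alpha> t"
    proof (rule neumann_maximum_principle[OF \<open>a < b\<close>, where z = "\<lambda>t. T \<alpha> t - \<alpha> t"])
      fix s assume s: "s \<in> {a..b}"
      show "((\<lambda>t. T \<alpha> t - \<alpha> t) has_real_derivative T' \<alpha> s - \<alpha>' s) (at s within {a..b})"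
        by (intro DERIV_diff DT \<alpha> c\<alpha> s)
      show "((\<lambda>t. T' \<alpha> t - \<alpha>' t) has_real_derivative
         (k\<^sup>2 * T \<alpha> s - (k\<^sup>2 * \<alpha> s - f s (\<alpha> s))) - \<alpha>'' s) (at s within {a..b})"
        by (intro DERIV_diff DT \<alpha>' c\<alpha> s)
      assume "T \<alpha> s - \<alpha> s < 0"
      then have "k\<^sup>2 * (T \<alpha> s - \<alpha> s) < 0"
        using \<open>k > 0\<close> by (simp add: mult_pos_neg)
      then show "(k\<^sup>2 * T \<alpha> s - (k\<^sup>2 * \<alpha> s - f s (\<alpha> s))) - \<alpha>'' s < 0"
        using lower[OF s] by (simp add: algebra_simps)
    qed (use DT[OF c\<alpha> ab] \<alpha>bc that in auto)
    then show ?thesis by simp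
  qed
  have T_upper: "T \<beta> t \<le> \<beta> t" if "t \<in> {a..b}" for t
  proof -
    have "0 \<le> \<beta> t - T \<beta> t"
    proof (rule neumann_maximum_principle[OF \<open>a < b\<close>, where z = "\<lambda>t. \<beta> t - T \<beta> t"])
      fix s assume s: "s \<in> {a..b}"
      show "((\<lambda>t. \<beta> t - T \<beta> t) has_real_derivative \<beta>' s - T' \<beta> s) (at s within {a..b})"
        by (intro DERIV_diff DT \<beta> c\<beta> s)
      show "((\<lambda>t. \<beta>' t - T' \<beta> t) has_real_derivative
         \<beta>'' s - (k\<^sup>2 * T \<beta> s - (k\<^sup>2 * \<beta> s - f s (\<beta> s)))) (at s within {a..b})"
        by (intro DERIV_diff DT \<beta>' c\<beta> s)
      assume "\<beta> s - T \<beta> s < 0"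
      then have "k\<^sup>2 * (\<beta> s - T \<beta> s) < 0"
        using \<open>k > 0\<close> by (simp add: mult_pos_neg)
      then show "\<beta>'' s - (k\<^sup>2 * T \<beta> s - (k\<^sup>2 * \<beta> s - f s (\<beta> s))) < 0"
        using upper[OF s] by (simp add: algebra_simps)
    qed (use DT[OF c\<beta> ab] \<beta>bc that in auto)
    then show ?thesis by simp
  qed
  have T_ordint: "ordint (T v)" if "ordint v" for v
    unfolding ordint_def
  proof (intro conjI ballI)
    have v: "continuous_on {a..b} v" using that by (simp add: ordint_def)
    show "continuous_on {a..b} (T v)"
      using DT(1)[OF v] by (rule DERIV_continuous_on)
    fix t assume t: "t \<in> {a..b}"
    have "T \<alpha> t \<le> T v t"
      using T_mono[OF o\<alpha> that _ t] that by (simp add: ordint_def)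
    then show "\<alpha> t \<le> T v t"
      using T_lower[OF t] by linarith
    have "T v t \<le> T \<beta> t"
      using T_mono[OF that o\<beta> _ t] that by (simp add: ordint_def)
    then show "T v t \<le> \<beta> t"
      using T_upper[OF t] by linarith
  qed
  \<comment> \<open>Both \<open>k^2 * T v t\<close> and the source at \<open>v t\<close> lie between
    their values for \<alpha> and \<beta>, so \<open>C t\<close> bounds the second derivative of
    \<open>T v\<close> for every \<open>v\<close> in the order interval.\<close>
  define C where "C t = \<bar>k\<^sup>2 * \<alpha> t\<bar> + \<bar>k\<^sup>2 * \<beta> t\<bar> + \<bar>k\<^sup>2 * \<alpha> t - f t (\<alpha> t)\<bar> + \<bar>k\<^sup>2 * \<beta> t - f t (\<beta> t)\<bar>" for t
  have "continuous_on {a..b} C"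
    unfolding C_def by (intro continuous_intros c\<alpha> c\<beta> cf)
  then have "\<exists>B. \<forall>t\<in>{a..b}. C t \<le> B"
    using continuous_attains_sup[of "{a..b}" C] ab by auto
  then obtain B where B: "\<And>t. t \<in> {a..b} \<Longrightarrow> C t \<le> B"
    by blast
  have "0 \<le> C a" by (simp add: C_def)
  then have "B \<ge> 0" using B[OF ab] by linarith
  \<comment> \<open>Integrating the bound \<open>B\<close> from \<open>a\<close>, where the slope of
    \<open>T v\<close> is zero, bounds that slope by \<open>L\<close>.\<close>
  define L where "L = B * (b - a)"
  have "L \<ge> 0" using \<open>B \<ge> 0\<close> \<open>a < b\<close> by (simp add: L_def)
  have T_lip: "L-lipschitz_on {a..b} (T v)" if v: "ordint v" for v
  proof -
    have cv: "continuous_on {a..b} v" using v by (simp add: ordint_def)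
    have "norm (k\<^sup>2 * T v t - (k\<^sup>2 * v t - f t (v t))) \<le> B" if t: "t \<in> {a..b}" for t
    proof -
      have "k\<^sup>2 * \<alpha> t \<le> k\<^sup>2 * T v t" "k\<^sup>2 * T v t \<le> k\<^sup>2 * \<beta> t"
        using T_ordint[OF v] t by (auto simp: ordint_def intro!: mult_left_mono)
      moreover have "k\<^sup>2 * \<alpha> t - f t (\<alpha> t) \<le> k\<^sup>2 * v t - f t (v t)" "k\<^sup>2 * v t - f t (v t) \<le> k\<^sup>2 * \<beta> t - f t (\<beta> t)"
        using v t by (auto simp: ordint_def intro!: mono)
      ultimately show ?thesis
        using B[OF t] unfolding C_def real_norm_def by linarith
    qed
    then have "norm (T' v t - T' v a) \<le> B * norm (t - a)" if "t \<in> {a..b}" for t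
      using that ab DT(2)[OF cv] by (intro field_differentiable_bound[where S = "{a..b}"]) auto
    then have T'_bound: "norm (T' v t) \<le> L" if "t \<in> {a..b}" for t
      using that DT(3)[OF cv ab] mult_left_mono[of "t - a" "b - a" B] \<open>B \<ge> 0\<close> unfolding L_def by fastforce
    show ?thesis
    proof (rule lipschitz_onI)
      fix s t assume "s \<in> {a..b}" "t \<in> {a..b}"
      then show "dist (T v s) (T v t) \<le> L * dist s t"
        unfolding dist_norm using T'_bound DT(1)[OF cv]
        by (intro field_differentiable_bound[where S = "{a..b}"]) auto
    qed fact
  qed
  \<comment> \<open>The Lipschitz condition makes the pointwise supremum continuous, so that
    \<open>T\<close> can be applied to it.\<close>
  define S where "S = {v. ordint v \<and> L-lipschitz_on {a..b} v \<and> (\<forall>t\<in>{a..b}. v t \<le> T v t)}"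
  define u where "u t = (SUP v\<in>S. v t)" for t
  have S_T: "T v \<in> S" if v: "ordint v" "\<And>t. t \<in> {a..b} \<Longrightarrow> v t \<le> T v t" for v
    using v T_ordint T_lip T_mono unfolding S_def by blast
  \<comment> \<open>The witness is the image of \<alpha>, because \<alpha> itself need not be
    \<open>L\<close>-Lipschitz.\<close>
  have "T \<alpha> \<in> S"
    using S_T[OF o\<alpha> T_lower] .
  then have "S \<noteq> {}" by blast
  have bdd: "bdd_above ((\<lambda>v. v t) ` S)" if "t \<in> {a..b}" for t
    using that by (intro bdd_aboveI[of _ "\<beta> t"]) (auto simp: S_def ordint_def)
  have u_ub: "v t \<le> u t" if "v \<in> S" "t \<in> {a..b}" for v t
    unfolding u_def using that bdd by (intro cSUP_upper) auto
  have u_lub: "u t \<le> c" if "\<And>v. v \<in> S \<Longrightarrow> v t \<le> c" for c t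
    unfolding u_def using that \<open>S \<noteq> {}\<close> by (intro cSUP_least) auto
  have "L-lipschitz_on {a..b} u"
  proof (rule lipschitz_onI)
    have *: "u s \<le> u t + L * dist s t" if "s \<in> {a..b}" "t \<in> {a..b}" for s t
    proof (rule u_lub)
      fix v assume "v \<in> S"
      then have "dist (v s) (v t) \<le> L * dist s t"
        using that by (auto simp: S_def dest: lipschitz_onD)
      then show "v s \<le> u t + L * dist s t"
        using u_ub[OF \<open>v \<in> S\<close> that(2)] by (simp add: dist_real_def)
    qed
    fix s t assume st: "s \<in> {a..b}" "t \<in> {a..b}"
    show "dist (u s) (u t) \<le> L * dist s t"
      using *[OF st] *[OF st(2,1)] by (simp add: dist_real_def abs_minus_commute)
  qed fact
  then have cu: "continuous_on {a..b} u"
    by (rule lipschitz_on_continuous_on)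
  have ou: "ordint u"
    unfolding ordint_def
  proof (intro conjI ballI cu)
    fix t assume t: "t \<in> {a..b}"
    show "\<alpha> t \<le> u t"
      using T_lower[OF t] u_ub[OF \<open>T \<alpha> \<in> S\<close> t] by linarith
    show "u t \<le> \<beta> t"
      using t by (intro u_lub) (auto simp: S_def ordint_def)
  qed
  have u_le: "u t \<le> T u t" if t: "t \<in> {a..b}" for t
  proof (rule u_lub)
    fix v assume v: "v \<in> S"
    then have "v t \<le> T v t" "ordint v" using t by (auto simp: S_def)
    then show "v t \<le> T u t"
      using T_mono[OF _ ou u_ub[OF v] t] by fastforce
  qed
  \<comment> \<open>From \<open>u \<le> T u\<close> it follows that \<open>T u\<close> belongs to
    \<open>S\<close>, hence lies below the supremum \<open>u\<close>.\<close>
  have fix_u: "T u t = u t" if "t \<in> {a..b}" for t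
    using u_le[OF that] u_ub[OF S_T[OF ou u_le] that] by simp
  show ?thesis
  \<comment> \<open>The derivatives are known for \<open>T u\<close>, which is shown to agree with
    \<open>u\<close> on \<open>{a..b}\<close> only.\<close>
  proof (rule that[of "T u" "T' u"])
    fix t assume t: "t \<in> {a..b}"
    show "(T u has_real_derivative T' u t) (at t within {a..b})"
      using DT(1)[OF cu t] .
    show "(T' u has_real_derivative f t (T u t)) (at t within {a..b})"
      using DT(2)[OF cu t] fix_u[OF t] by simp
    show "\<alpha> t \<le> T u t \<and> T u t \<le> \<beta> t"
      using T_ordint[OF ou] t by (simp add: ordint_def)
  qed (use DT[OF cu ab] in auto)
qed

section \<open>The positive lower solution near \<open>lambda0\<close>\<close>

text \<open>The number \<open>m\<close> is the double root of \<open>x^3 - lambda0 * x + 1\<close>: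
  the two equations say that this cubic and its derivative vanish at \<open>m\<close>.\<close>

lemma lambda0_eq:
  obtains m :: real where "0 < m" "m < 1" "2 * m ^ 3 = 1" "lambda0 = 3 * m\<^sup>2"
proof
  define m :: real where "m = 2 powr (- (1 / 3))"
  show "0 < m" by (simp add: m_def)
  show "m < 1" unfolding m_def using powr_less_mono[of "- (1 / 3)" 0 "2 :: real"] by simp
  have "m ^ 3 = 2 powr (- 1)" "m\<^sup>2 = 2 powr (- (2 / 3))"
    unfolding m_def by (simp_all add: powr_power)
  then show "2 * m ^ 3 = 1" "lambda0 = 3 * m\<^sup>2"
    by (simp_all add: lambda0_def powr_minus field_simps)
qed

text \<open>With \<open>x = \<eta> * c\<close> and \<open>lam = 3 * m^2\<close> the terms linear in
  \<open>x\<close> cancel, leaving \<open>c - 1 + (3 * m - x) * x^2\<close>. The quadratic term and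
  the decrease of \<open>lam\<close> each cost at most \<epsilon>^2 * \<eta> / 2. The total
  \<epsilon>^2 * \<eta> - (1 - c) is at most \<epsilon>^2 * \<eta> * c because \<epsilon>^2 * \<eta>
  \<le> 1.\<close>

lemma lower_solution_inequality:
  fixes m \<eta> \<epsilon> lam c :: real
  assumes m: "0 < m" "m < 1" "2 * m ^ 3 = 1"
    and \<eta>: "0 < \<eta>" "\<eta> \<le> m" "8 * \<eta> \<le> \<epsilon>\<^sup>2" "\<epsilon>\<^sup>2 * \<eta> \<le> 1"
    and c: "- 1 \<le> c" "c \<le> 1"
    and lam: "3 * m\<^sup>2 - \<epsilon>\<^sup>2 * \<eta> / 4 \<le> lam"
  shows "(m - \<eta> * c) ^ 3 - lam * (m - \<eta> * c) + c \<le> \<epsilon>\<^sup>2 * (\<eta> * c)"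
proof -
  have \<eta>c: "\<bar>\<eta> * c\<bar> \<le> \<eta>"
    using \<eta> c mult_left_mono[of "\<bar>c\<bar>" 1 \<eta>] by (simp add: abs_mult)
  define x where "x = \<eta> * c"
  have x: "- \<eta> \<le> x" "x \<le> \<eta>" using \<eta>c unfolding x_def by auto
  have x2: "x\<^sup>2 \<le> \<eta>\<^sup>2" using x by (simp add: abs_le_square_iff[symmetric])
  have "(3 * m\<^sup>2 - \<epsilon>\<^sup>2 * \<eta> / 4) * (m - x) \<le> lam * (m - x)"
    using lam x \<eta> by (intro mult_right_mono) auto
  moreover have "\<epsilon>\<^sup>2 * \<eta> / 4 * (m - x) \<le> \<epsilon>\<^sup>2 * \<eta> / 4 * 2"
    using x \<eta> m by (intro mult_left_mono) auto
  moreover have "(3 * m - x) * x\<^sup>2 \<le> 4 * \<eta>\<^sup>2"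
    using x x2 m \<eta> by (intro mult_mono) auto
  moreover have "8 * \<eta> * \<eta> \<le> \<epsilon>\<^sup>2 * \<eta>"
    using \<eta> by (intro mult_right_mono) auto
  moreover have "0 \<le> (1 - c) * (1 - \<epsilon>\<^sup>2 * \<eta>)"
    using c \<eta> by simp
  moreover have "(m - x) ^ 3 = m ^ 3 - 3 * m\<^sup>2 * x + (3 * m - x) * x\<^sup>2"
    by (simp add: algebra_simps power2_eq_square power3_eq_cube)
  moreover have "(3 * m\<^sup>2 - \<epsilon>\<^sup>2 * \<eta> / 4) * (m - x) = 3 * m ^ 3 - 3 * m\<^sup>2 * x - \<epsilon>\<^sup>2 * \<eta> / 4 * (m - x)"
    by (simp add: algebra_simps power2_eq_square power3_eq_cube)
  moreover have "(1 - c) * (1 - \<epsilon>\<^sup>2 * \<eta>) = 1 - c - \<epsilon>\<^sup>2 * \<eta> + \<epsilon>\<^sup>2 * x"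
    by (simp add: algebra_simps x_def)
  ultimately have "(m - x) ^ 3 - lam * (m - x) + c \<le> \<epsilon>\<^sup>2 * x"
    using m(3) by (simp add: power2_eq_square)
  then show ?thesis by (simp add: x_def)
qed

lemma positive_bvp_solution:
  fixes m \<eta> \<epsilon> lam :: real
  assumes "0 < \<epsilon>" and m: "0 < m" "m < 1" "2 * m ^ 3 = 1"
    and \<eta>: "0 < \<eta>" "\<eta> < m" "8 * \<eta> \<le> \<epsilon>\<^sup>2" "\<epsilon>\<^sup>2 * \<eta> \<le> 1"
    and lam: "3 * m\<^sup>2 - \<epsilon>\<^sup>2 * \<eta> / 4 \<le> lam" "0 \<le> lam"
  obtains u where "bvp_solution \<epsilon> lam u" "\<And>t. t \<in> {0..pi} \<Longrightarrow> 0 < u t"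
proof -
  \<comment> \<open>Any constant with \<open>M^3 - lam * M \<ge> 1\<close> is an upper solution; for
    this one the left side is a polynomial in \<open>lam\<close> with nonnegative coefficients and
    constant term 8.\<close>
  define M where "M = lam + 2"
  define f where "f t x = (x ^ 3 - lam * x + cos t) / \<epsilon>\<^sup>2" for t x
  have \<eta>c: "\<bar>\<eta> * cos t\<bar> \<le> \<eta>" for t
    using \<eta> mult_left_mono[of "\<bar>cos t\<bar>" 1 \<eta>] by (simp add: abs_mult)
  have pos: "0 < m - \<eta> * cos t" for t
    using \<eta>c[of t] \<eta> by linarith
  have M: "M > 0" using lam by (simp add: M_def)
  obtain u u' where u:
    "\<And>t. t \<in> {0..pi} \<Longrightarrow> (u has_real_derivative u' t) (at t within {0..pi})"
    "\<And>t. t \<in> {0..pi} \<Longrightarrow> (u' has_real_derivative f t (u t)) (at t within {0..pi})"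
    "u' 0 = 0" "u' pi = 0"
    "\<And>t. t \<in> {0..pi} \<Longrightarrow> m - \<eta> * cos t \<le> u t \<and> u t \<le> M"
  \<comment> \<open>On \<open>0 \<le> x \<le> M\<close> the slope of \<open>f t\<close> is at most
    \<open>3 * M^2\<close> over \<epsilon>^2, so \<open>k = 2 * M / \<epsilon>\<close> is large
    enough for monotonicity.\<close>
  proof (rule neumann_between_lower_and_upper_solution[of 0 pi "2 * M / \<epsilon>" f "\<lambda>t. m - \<eta> * cos t" "\<lambda>_. M"
        "\<lambda>t. \<eta> * sin t" "\<lambda>t. \<eta> * cos t" "\<lambda>_. 0" "\<lambda>_. 0"])
    show "continuous_on ({0..pi} \<times> UNIV) (\<lambda>(t, x). f t x)"
      unfolding f_def case_prod_unfold using \<open>0 < \<epsilon>\<close> by (intro continuous_intros) auto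
  next
    fix t x y assume xy: "m - \<eta> * cos t \<le> x" "x \<le> y" "y \<le> M"
    then have "0 \<le> x" using pos[of t] by linarith
    then have "x * x \<le> M * M" "x * y \<le> M * M" "y * y \<le> M * M"
      using xy by (auto intro!: mult_mono)
    moreover have "0 \<le> M * M" by simp
    ultimately have "0 \<le> 4 * (M * M) + lam - (x * x + x * y + y * y)"
      \<comment> \<open>This is the cofactor of \<open>y - x\<close> in the increment, multiplied by
        \<epsilon>^2, of \<open>k^2 * x - f t x\<close> from \<open>x\<close> to
        \<open>y\<close>.\<close>
      using lam by linarith
    then have "0 \<le> (y - x) * (4 * (M * M) + lam - (x * x + x * y + y * y))"
      using xy by (intro mult_nonneg_nonneg) auto
    then have "4 * M\<^sup>2 * x - (x ^ 3 - lam * x + cos t) \<le> 4 * M\<^sup>2 * y - (y ^ 3 - lam * y + cos t)"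
      by (simp add: algebra_simps power2_eq_square power3_eq_cube)
    then have "(4 * M\<^sup>2 * x - (x ^ 3 - lam * x + cos t)) / \<epsilon>\<^sup>2
        \<le> (4 * M\<^sup>2 * y - (y ^ 3 - lam * y + cos t)) / \<epsilon>\<^sup>2"
      by (intro divide_right_mono) auto
    then show "(2 * M / \<epsilon>)\<^sup>2 * x - f t x \<le> (2 * M / \<epsilon>)\<^sup>2 * y - f t y"
      by (simp add: f_def power_divide power_mult_distrib diff_divide_distrib)
  next
    fix t
    show "f t (m - \<eta> * cos t) \<le> \<eta> * cos t"
      using lower_solution_inequality[of m \<eta> \<epsilon> "cos t" lam] m \<eta> lam \<open>0 < \<epsilon>\<close>
      by (simp add: f_def divide_le_eq mult.commute)
    have "lam * lam * lam \<ge> 0" "lam * lam \<ge> 0" "lam \<ge> 0" using lam by auto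
    moreover have "M ^ 3 - lam * M = lam * lam * lam + 5 * (lam * lam) + 10 * lam + 8"
      by (simp add: M_def power3_eq_cube algebra_simps)
    ultimately have "0 \<le> M ^ 3 - lam * M + cos t"
      using cos_ge_minus_one[of t] by linarith
    then show "0 \<le> f t M"
      by (simp add: f_def)
    show "m - \<eta> * cos t \<le> M"
      using \<eta>c[of t] \<eta> m lam by (auto simp: M_def)
  qed (use M \<open>0 < \<epsilon>\<close> in \<open>auto intro!: derivative_eq_intros\<close>)
  show ?thesis
  proof
    have "\<epsilon>\<^sup>2 * f t x = x ^ 3 - lam * x + cos t" for t x
      using \<open>0 < \<epsilon>\<close> by (simp add: f_def)
    then show "bvp_solution \<epsilon> lam u"
      unfolding bvp_solution_def solution_on_def using u by blast
    show "0 < u t" if "t \<in> {0..pi}" for t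
      using u(5)[OF that] pos[of t] by linarith
  qed
qed

section \<open>The strict bound for the supremum\<close>

theorem theorem10:
  fixes \<epsilon> :: real
  assumes "\<epsilon> > 0"
  shows "lambda_b \<epsilon> < ereal lambda0"
proof -
  obtain m :: real where m: "0 < m" "m < 1" "2 * m ^ 3 = 1" and lam0: "lambda0 = 3 * m\<^sup>2"
    by (rule lambda0_eq)
  \<comment> \<open>The three bounds give in turn positivity of the lower solution, control of its
    quadratic error, and \<epsilon>^2 * \<eta> \<le> 1.\<close>
  define \<eta> where "\<eta> = min (m / 2) (min (\<epsilon>\<^sup>2 / 8) (1 / \<epsilon>\<^sup>2))"
  have "\<eta> \<le> 1 / \<epsilon>\<^sup>2" by (simp add: \<eta>_def)
  then have \<eta>: "0 < \<eta>" "\<eta> < m" "8 * \<eta> \<le> \<epsilon>\<^sup>2" "\<epsilon>\<^sup>2 * \<eta> \<le> 1"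
    using m assms by (auto simp: \<eta>_def field_simps)
  define lam1 where "lam1 = lambda0 - \<epsilon>\<^sup>2 * \<eta> / 4"
  \<comment> \<open>This gives \<open>m^2 \<ge> 1/2\<close>, so \<open>lambda0\<close> is at least
    3/2, while at most 1/4 is subtracted from it.\<close>
  have "m ^ 3 \<le> m\<^sup>2"
    using m by (intro power_decreasing) auto
  then have "0 \<le> lam1"
    using m \<eta> unfolding lam1_def lam0 by linarith
  have "lam \<le> lam1" if "only_u_p \<epsilon> lam" for lam
  proof (rule ccontr)
    assume "\<not> lam \<le> lam1"
    then have "3 * m\<^sup>2 - \<epsilon>\<^sup>2 * \<eta> / 4 \<le> lam" "0 \<le> lam"
      using \<open>0 \<le> lam1\<close> by (simp_all add: lam1_def lam0)
    then obtain v where v: "bvp_solution \<epsilon> lam v" "\<And>t. t \<in> {0..pi} \<Longrightarrow> 0 < v t"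
      using positive_bvp_solution[OF assms m \<eta>] by blast
    from that v(1) obtain u where "is_u_p \<epsilon> lam u" "\<forall>t\<in>{0..pi}. v t = u t"
      unfolding only_u_p_def by blast
    then have "v (pi / 2) = 0"
      by (auto simp: is_u_p_def)
    then show False
      using v(2)[of "pi / 2"] by simp
  qed
  \<comment> \<open>The gap between \<open>lam1\<close> and \<open>lambda0\<close> does not depend
    on \<open>lam\<close>, which keeps the inequality strict in the supremum. An empty set would
    give minus infinity, for which the bound holds as well.\<close>
  then have "lambda_b \<epsilon> \<le> ereal lam1"
    unfolding lambda_b_def by (intro Sup_least) auto
  also have "\<dots> < ereal lambda0"
    using \<eta> assms by (simp add: lam1_def)
  finally show ?thesis .
qed

end
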